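(* The rule (UC): from $(p\rightsquigarrow\phi)\wedge\Box p\to\psi$ infer $\Box\phi\to\psi$ (where $p$ is a propositional variable not occurring in $\phi,\psi$) is admissible in $\mathsf{MS^2IC}$: whenever $(p\rightsquigarrow\phi)\wedge\Box p\to\psi$ is a theorem of $\mathsf{MS^2IC}$ with $p$ not occurring in $\phi,\psi$, so is $\Box\phi\to\psi$.
   Context: Language: propositional variables, $\top,\bot$, $\neg,\wedge,\vee,\to,\leftrightarrow$, a binary connective $\rightsquigarrow$ and a unary modality $\Box$; $\Diamond\phi:=\neg\Box\neg\phi$, $[\forall]\phi:=\top\rightsquigarrow\phi$. $\mathsf{MS^2IC}$: theorems are the least set containing all instances of classical tautologies and of (A1) $(\bot\rightsquigarrow\phi)\wedge(\phi\rightsquigarrow\top)$; (A2) $((\phi\vee\psi)\rightsquigarrow\chi)\leftrightarrow((\phi\rightsquigarrow\chi)\wedge(\psi\rightsquigarrow\chi))$; (A3) $(\phi\rightsquigarrow(\psi\wedge\chi))\leftrightarrow((\phi\rightsquigarrow\psi)\wedge(\phi\rightsquigarrow\chi))$; (A4) $(\phi\rightsquigarrow\psi)\to(\phi\to\psi)$; (A5) $(\phi\rightsquigarrow\psi)\leftrightarrow(\neg\psi\rightsquigarrow\neg\phi)$; (A8) $[\forall]\phi\to[\forall][\forall]\phi$; (A9) $\neg[\forall]\phi\to[\forall]\neg[\forall]\phi$; (A10) $(\phi\rightsquigarrow\psi)\leftrightarrow[\forall](\phi\rightsquigarrow\psi)$; (A11) $[\forall]\phi\to(\neg[\forall]\phi\rightsquigarrow\bot)$;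 (K) $\Box(\phi\to\psi)\to(\Box\phi\to\Box\psi)$; (Add) $(\phi\rightsquigarrow\psi)\to(\Box\phi\rightsquigarrow\Box\psi)$; closed under modus ponens, from $\phi$ infer $[\forall]\phi$, from $\phi$ infer $\Box\phi$. *)

theory Defs
  imports Main
begin

datatype (vars: 'v) fm =
    Var 'v
  | Top (\<open>\<^bold>\<top>\<close>)
  | Bot (\<open>\<^bold>\<bottom>\<close>)
  | Neg \<open>'v fm\<close> (\<open>\<^bold>\<not> _\<close> [90] 90)
  | And \<open>'v fm\<close> \<open>'v fm\<close> (infixr \<open>\<^bold>\<and>\<close> 80)
  | Or \<open>'v fm\<close> \<open>'v fm\<close> (infixr \<open>\<^bold>\<or>\<close> 75)
  | Imp \<open>'v fm\<close> \<open>'v fm\<close> (infixr \<open>\<^bold>\<longrightarrow>\<close> 65)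
  | Iff \<open>'v fm\<close> \<open>'v fm\<close> (infix \<open>\<^bold>\<longleftrightarrow>\<close> 60)
  | SImp \<open>'v fm\<close> \<open>'v fm\<close> (infix \<open>\<^bold>\<leadsto>\<close> 70)
  | Box \<open>'v fm\<close> (\<open>\<^bold>\<box> _\<close> [90] 90)

abbreviation Univ :: "'v fm \<Rightarrow> 'v fm" (\<open>\<^bold>[\<forall>\<^bold>] _\<close> [90] 90) where
  "\<^bold>[\<forall>\<^bold>] \<phi> \<equiv> \<^bold>\<top> \<^bold>\<leadsto> \<phi>"

(* Classical propositional formulas get countably many schematic letters of their own,
   independent of 'v, so that all tautology instances are available for any choice of 'v. *)
datatype cpl =
    CVar nat
  | CTop
  | CBot
  | CNeg cpl
  | CAnd cpl cpl
  | COr cpl cpl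
  | CImp cpl cpl
  | CIff cpl cpl

primrec ceval :: "(nat \<Rightarrow> bool) \<Rightarrow> cpl \<Rightarrow> bool" where
  "ceval v (CVar n) = v n"
| "ceval v CTop = True"
| "ceval v CBot = False"
| "ceval v (CNeg a) = (\<not> ceval v a)"
| "ceval v (CAnd a b) = (ceval v a \<and> ceval v b)"
| "ceval v (COr a b) = (ceval v a \<or> ceval v b)"
| "ceval v (CImp a b) = (ceval v a \<longrightarrow> ceval v b)"
| "ceval v (CIff a b) = (ceval v a \<longleftrightarrow> ceval v b)"

definition tautology :: "cpl \<Rightarrow> bool" where
  "tautology a \<longleftrightarrow> (\<forall>v. ceval v a)"

primrec inst :: "(nat \<Rightarrow> 'v fm) \<Rightarrow> cpl \<Rightarrow> 'v fm" where
  "inst \<sigma> (CVar n) = \<sigma> n"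
| "inst \<sigma> CTop = \<^bold>\<top>"
| "inst \<sigma> CBot = \<^bold>\<bottom>"
| "inst \<sigma> (CNeg a) = \<^bold>\<not> inst \<sigma> a"
| "inst \<sigma> (CAnd a b) = inst \<sigma> a \<^bold>\<and> inst \<sigma> b"
| "inst \<sigma> (COr a b) = inst \<sigma> a \<^bold>\<or> inst \<sigma> b"
| "inst \<sigma> (CImp a b) = (inst \<sigma> a \<^bold>\<longrightarrow> inst \<sigma> b)"
| "inst \<sigma> (CIff a b) = (inst \<sigma> a \<^bold>\<longleftrightarrow> inst \<sigma> b)"

inductive MS2IC :: "'v fm \<Rightarrow> bool" (\<open>\<turnstile> _\<close> [50] 50) where
  Taut: "tautology a \<Longrightarrow> \<turnstile> inst \<sigma> a"
| A1: "\<turnstile> (\<^bold>\<bottom> \<^bold>\<leadsto> \<phi>) \<^bold>\<and> (\<phi> \<^bold>\<leadsto> \<^bold>\<top>)"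
| A2: "\<turnstile> ((\<phi> \<^bold>\<or> \<psi>) \<^bold>\<leadsto> \<chi>) \<^bold>\<longleftrightarrow> ((\<phi> \<^bold>\<leadsto> \<chi>) \<^bold>\<and> (\<psi> \<^bold>\<leadsto> \<chi>))"
| A3: "\<turnstile> (\<phi> \<^bold>\<leadsto> (\<psi> \<^bold>\<and> \<chi>)) \<^bold>\<longleftrightarrow> ((\<phi> \<^bold>\<leadsto> \<psi>) \<^bold>\<and> (\<phi> \<^bold>\<leadsto> \<chi>))"
| A4: "\<turnstile> (\<phi> \<^bold>\<leadsto> \<psi>) \<^bold>\<longrightarrow> (\<phi> \<^bold>\<longrightarrow> \<psi>)"
| A5: "\<turnstile> (\<phi> \<^bold>\<leadsto> \<psi>) \<^bold>\<longleftrightarrow> ((\<^bold>\<not> \<psi>) \<^bold>\<leadsto> (\<^bold>\<not> \<phi>))"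
| A8: "\<turnstile> (\<^bold>[\<forall>\<^bold>] \<phi>) \<^bold>\<longrightarrow> (\<^bold>[\<forall>\<^bold>] (\<^bold>[\<forall>\<^bold>] \<phi>))"
| A9: "\<turnstile> (\<^bold>\<not> (\<^bold>[\<forall>\<^bold>] \<phi>)) \<^bold>\<longrightarrow> (\<^bold>[\<forall>\<^bold>] (\<^bold>\<not> (\<^bold>[\<forall>\<^bold>] \<phi>)))"
| A10: "\<turnstile> (\<phi> \<^bold>\<leadsto> \<psi>) \<^bold>\<longleftrightarrow> (\<^bold>[\<forall>\<^bold>] (\<phi> \<^bold>\<leadsto> \<psi>))"
| A11: "\<turnstile> (\<^bold>[\<forall>\<^bold>] \<phi>) \<^bold>\<longrightarrow> ((\<^bold>\<not> (\<^bold>[\<forall>\<^bold>] \<phi>)) \<^bold>\<leadsto> \<^bold>\<bottom>)"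
| K: "\<turnstile> (\<^bold>\<box> (\<phi> \<^bold>\<longrightarrow> \<psi>)) \<^bold>\<longrightarrow> ((\<^bold>\<box> \<phi>) \<^bold>\<longrightarrow> (\<^bold>\<box> \<psi>))"
| Add: "\<turnstile> (\<phi> \<^bold>\<leadsto> \<psi>) \<^bold>\<longrightarrow> ((\<^bold>\<box> \<phi>) \<^bold>\<leadsto> (\<^bold>\<box> \<psi>))"
| MP: "\<turnstile> \<phi> \<^bold>\<longrightarrow> \<psi> \<Longrightarrow> \<turnstile> \<phi> \<Longrightarrow> \<turnstile> \<psi>"
| Univ_Nec: "\<turnstile> \<phi> \<Longrightarrow> \<turnstile> \<^bold>[\<forall>\<^bold>] \<phi>"
| Box_Nec: "\<turnstile> \<phi> \<Longrightarrow> \<turnstile> \<^bold>\<box> \<phi>"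

end

theory Submission
  imports Defs
begin

text \<open>
  The calculus does not prove replacement of equivalents under \<open>\<leadsto>\<close>
  (\<open>(r \<leadsto> q) \<longrightarrow> ((r \<and> r) \<leadsto> q)\<close> is not a theorem), so one cannot argue with algebras
  in which \<open>\<leadsto>\<close> is an operation. Instead, suppose that \<open>\<box>\<phi> \<longrightarrow> \<psi>\<close> is not a theorem and let
  \<open>F\<close> be a maximal consistent set omitting it. Every formula \<open>\<alpha> \<leadsto> \<beta>\<close> is decided by \<open>F\<close>, and
  this decision persists under \<open>\<box>\<close>. Translate formulas by \<open>p \<mapsto> \<phi>\<close>, commuting with the
  Boolean connectives and \<open>\<box>\<close>, and sending each \<open>\<alpha> \<leadsto> \<beta>\<close> to a truth constant: (A2), (A3) and
  (A5) reduce \<open>\<alpha> \<leadsto> \<beta>\<close> to irreducible components \<open>\<gamma> \<leadsto> \<delta>\<close>; a component without \<open>p\<close>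
  counts as true if it is in \<open>F\<close>, a component with \<open>p\<close> if the translation of \<open>\<gamma> \<longrightarrow> \<delta>\<close>
  follows from the \<open>\<box>\<close>-persistent part of \<open>F\<close>. This translation preserves theorems, fixes
  formulas without \<open>p\<close> up to equivalence, and makes \<open>p \<leadsto> \<phi>\<close> true.
\<close>

section \<open>Deductively closed and maximal consistent sets\<close>

text \<open>Necessitation is left out, so that the deduction theorem applies to an adjoined
  premise.\<close>

definition closed :: "'v fm set \<Rightarrow> bool" where
  "closed T \<longleftrightarrow> (\<forall>\<alpha>. \<turnstile> \<alpha> \<longrightarrow> \<alpha> \<in> T) \<and> (\<forall>\<alpha> \<beta>. (\<alpha> \<^bold>\<longrightarrow> \<beta>) \<in> T \<longrightarrow> \<alpha> \<in> T \<longrightarrow> \<beta> \<in> T)"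

definition ultra :: "'v fm set \<Rightarrow> bool" where
  "ultra U \<longleftrightarrow> closed U \<and> (\<forall>\<alpha>. (\<^bold>\<not> \<alpha>) \<in> U \<longleftrightarrow> \<alpha> \<notin> U)"

lemma closed_theorem: "closed T \<Longrightarrow> \<turnstile> \<alpha> \<Longrightarrow> \<alpha> \<in> T"
  and closed_MP: "closed T \<Longrightarrow> (\<alpha> \<^bold>\<longrightarrow> \<beta>) \<in> T \<Longrightarrow> \<alpha> \<in> T \<Longrightarrow> \<beta> \<in> T"
  by (auto simp: closed_def)

lemma closed_theorems: "closed {\<alpha>. \<turnstile> \<alpha>}"
  by (auto simp: closed_def intro: MP)

lemma taut3:
  assumes "tautology c" shows "\<turnstile> inst (\<lambda>n. if n = 0 then \<alpha> else if n = 1 then \<beta> else \<gamma>) c"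
  using assms by (rule Taut)

text \<open>Enough for Lindenbaum's lemma and the truth conditions of the connectives; larger
  propositional arguments are then settled inside \<open>ultra\<close> sets instead of by
  derivations.\<close>

lemma tautologies:
  fixes \<alpha> \<beta> \<gamma> :: "'v fm"
  shows taut_K: "\<turnstile> \<alpha> \<^bold>\<longrightarrow> (\<beta> \<^bold>\<longrightarrow> \<alpha>)"
    and taut_S: "\<turnstile> (\<gamma> \<^bold>\<longrightarrow> (\<alpha> \<^bold>\<longrightarrow> \<beta>)) \<^bold>\<longrightarrow> ((\<gamma> \<^bold>\<longrightarrow> \<alpha>) \<^bold>\<longrightarrow> (\<gamma> \<^bold>\<longrightarrow> \<beta>))"
    and taut_I: "\<turnstile> \<alpha> \<^bold>\<longrightarrow> \<alpha>"
    and taut_cases: "\<turnstile> (\<alpha> \<^bold>\<longrightarrow> \<beta>) \<^bold>\<longrightarrow> ((\<^bold>\<not> \<alpha> \<^bold>\<longrightarrow> \<beta>) \<^bold>\<longrightarrow> \<beta>)"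
    and taut_absurd: "\<turnstile> \<^bold>\<not> \<alpha> \<^bold>\<longrightarrow> (\<alpha> \<^bold>\<longrightarrow> \<beta>)"
    and taut_Top: "\<turnstile> (\<^bold>\<top> :: 'v fm)"
    and taut_Bot: "\<turnstile> \<^bold>\<not> (\<^bold>\<bottom> :: 'v fm)"
    and taut_And: "\<turnstile> \<alpha> \<^bold>\<and> \<beta> \<^bold>\<longrightarrow> \<alpha>" "\<turnstile> \<alpha> \<^bold>\<and> \<beta> \<^bold>\<longrightarrow> \<beta>" "\<turnstile> \<alpha> \<^bold>\<longrightarrow> (\<beta> \<^bold>\<longrightarrow> \<alpha> \<^bold>\<and> \<beta>)"
    and taut_Or: "\<turnstile> \<alpha> \<^bold>\<longrightarrow> \<alpha> \<^bold>\<or> \<beta>" "\<turnstile> \<beta> \<^bold>\<longrightarrow> \<alpha> \<^bold>\<or> \<beta>" "\<turnstile> \<alpha> \<^bold>\<or> \<beta> \<^bold>\<longrightarrow> (\<^bold>\<not> \<alpha> \<^bold>\<longrightarrow> \<beta>)"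
    and taut_Iff: "\<turnstile> (\<alpha> \<^bold>\<longleftrightarrow> \<beta>) \<^bold>\<longrightarrow> (\<alpha> \<^bold>\<longrightarrow> \<beta>)" "\<turnstile> (\<alpha> \<^bold>\<longleftrightarrow> \<beta>) \<^bold>\<longrightarrow> (\<beta> \<^bold>\<longrightarrow> \<alpha>)"
      "\<turnstile> \<alpha> \<^bold>\<longrightarrow> (\<beta> \<^bold>\<longrightarrow> (\<alpha> \<^bold>\<longleftrightarrow> \<beta>))" "\<turnstile> \<^bold>\<not> \<alpha> \<^bold>\<longrightarrow> (\<^bold>\<not> \<beta> \<^bold>\<longrightarrow> (\<alpha> \<^bold>\<longleftrightarrow> \<beta>))"
  using taut3[of "CImp (CVar 0) (CImp (CVar 1) (CVar 0))" \<alpha> \<beta> \<gamma>]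
    taut3[of "CImp (CImp (CVar 2) (CImp (CVar 0) (CVar 1)))
      (CImp (CImp (CVar 2) (CVar 0)) (CImp (CVar 2) (CVar 1)))" \<alpha> \<beta> \<gamma>]
    taut3[of "CImp (CVar 0) (CVar 0)" \<alpha> \<beta> \<gamma>]
    taut3[of "CImp (CImp (CVar 0) (CVar 1)) (CImp (CImp (CNeg (CVar 0)) (CVar 1)) (CVar 1))" \<alpha> \<beta> \<gamma>]
    taut3[of "CImp (CNeg (CVar 0)) (CImp (CVar 0) (CVar 1))" \<alpha> \<beta> \<gamma>]
    taut3[of CTop \<alpha> \<beta> \<gamma>]
    taut3[of "CNeg CBot" \<alpha> \<beta> \<gamma>]
    taut3[of "CImp (CAnd (CVar 0) (CVar 1)) (CVar 0)" \<alpha> \<beta> \<gamma>]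
    taut3[of "CImp (CAnd (CVar 0) (CVar 1)) (CVar 1)" \<alpha> \<beta> \<gamma>]
    taut3[of "CImp (CVar 0) (CImp (CVar 1) (CAnd (CVar 0) (CVar 1)))" \<alpha> \<beta> \<gamma>]
    taut3[of "CImp (CVar 0) (COr (CVar 0) (CVar 1))" \<alpha> \<beta> \<gamma>]
    taut3[of "CImp (CVar 1) (COr (CVar 0) (CVar 1))" \<alpha> \<beta> \<gamma>]
    taut3[of "CImp (COr (CVar 0) (CVar 1)) (CImp (CNeg (CVar 0)) (CVar 1))" \<alpha> \<beta> \<gamma>]
    taut3[of "CImp (CIff (CVar 0) (CVar 1)) (CImp (CVar 0) (CVar 1))" \<alpha> \<beta> \<gamma>]
    taut3[of "CImp (CIff (CVar 0) (CVar 1)) (CImp (CVar 1) (CVar 0))" \<alpha> \<beta> \<gamma>]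
    taut3[of "CImp (CVar 0) (CImp (CVar 1) (CIff (CVar 0) (CVar 1)))" \<alpha> \<beta> \<gamma>]
    taut3[of "CImp (CNeg (CVar 0)) (CImp (CNeg (CVar 1)) (CIff (CVar 0) (CVar 1)))" \<alpha> \<beta> \<gamma>]
  by (auto simp: tautology_def)

text \<open>Deduction theorem: \<open>taut_S\<close> gives closure under modus ponens,
  \<open>taut_K\<close> the inclusion of \<open>T\<close>.\<close>

lemma closed_adjoin:
  assumes "closed T"
  shows "closed {\<beta>. (\<alpha> \<^bold>\<longrightarrow> \<beta>) \<in> T}" "T \<subseteq> {\<beta>. (\<alpha> \<^bold>\<longrightarrow> \<beta>) \<in> T}" "\<alpha> \<in> {\<beta>. (\<alpha> \<^bold>\<longrightarrow> \<beta>) \<in> T}"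
proof -
  have weaken: "(\<alpha> \<^bold>\<longrightarrow> \<beta>) \<in> T" if "\<beta> \<in> T" for \<beta>
    using assms closed_MP closed_theorem taut_K that by metis
  have "(\<alpha> \<^bold>\<longrightarrow> \<delta>) \<in> T" if "(\<alpha> \<^bold>\<longrightarrow> (\<beta> \<^bold>\<longrightarrow> \<delta>)) \<in> T" "(\<alpha> \<^bold>\<longrightarrow> \<beta>) \<in> T" for \<beta> \<delta>
    using closed_MP[OF assms closed_MP[OF assms closed_theorem[OF assms taut_S]]] that by blast
  then show "closed {\<beta>. (\<alpha> \<^bold>\<longrightarrow> \<beta>) \<in> T}"
    using assms weaken unfolding closed_def by blast
  show "T \<subseteq> {\<beta>. (\<alpha> \<^bold>\<longrightarrow> \<beta>) \<in> T}" using weaken by blast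
  show "\<alpha> \<in> {\<beta>. (\<alpha> \<^bold>\<longrightarrow> \<beta>) \<in> T}" using assms closed_theorem taut_I by blast
qed

text \<open>Lindenbaum's lemma by Zorn, so the set of variables may have any cardinality: a maximal
  closed set omitting \<open>\<theta>\<close> turns out to be \<open>ultra\<close>.\<close>

lemma ultra_extension:
  assumes "closed T" "\<theta> \<notin> T"
  obtains U where "ultra U" "T \<subseteq> U" "\<theta> \<notin> U"
proof -
  let ?A = "{U. closed U \<and> T \<subseteq> U \<and> \<theta> \<notin> U}"
  have "\<exists>M\<in>?A. \<forall>X\<in>?A. M \<subseteq> X \<longrightarrow> X = M"
  proof (rule subset_Zorn_nonempty)
    show "?A \<noteq> {}" using assms by blast
    fix C assume C: "C \<noteq> {}" "subset.chain ?A C"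
    then have mem: "closed X" "T \<subseteq> X" "\<theta> \<notin> X" if "X \<in> C" for X
      using that by (auto simp: subset.chain_def)
    have "\<beta> \<in> \<Union>C" if ab: "(\<alpha> \<^bold>\<longrightarrow> \<beta>) \<in> \<Union>C" "\<alpha> \<in> \<Union>C" for \<alpha> \<beta>
    proof -
      obtain X Y where XY: "X \<in> C" "(\<alpha> \<^bold>\<longrightarrow> \<beta>) \<in> X" "Y \<in> C" "\<alpha> \<in> Y" using ab by blast
      then have "X \<subseteq> Y \<or> Y \<subseteq> X" using C(2) by (auto simp: subset_chain_def)
      then show ?thesis using XY mem(1) closed_MP by blast
    qed
    then have "closed (\<Union>C)" using C(1) mem(1) unfolding closed_def by blast
    then show "\<Union>C \<in> ?A" using C(1) mem by blast
  qed
  then obtain U where "U \<in> ?A" and maximal: "\<forall>X\<in>?A. U \<subseteq> X \<longrightarrow> X = U" ..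
  then have U: "closed U" "T \<subseteq> U" "\<theta> \<notin> U" by auto
  \<comment> \<open>Adjoining \<open>\<alpha>\<close> enlarges \<open>U\<close> properly, so by
    maximality the enlarged set contains \<open>\<theta>\<close>.\<close>
  have outside: "(\<alpha> \<^bold>\<longrightarrow> \<theta>) \<in> U" if "\<alpha> \<notin> U" for \<alpha>
  proof (rule ccontr)
    assume "(\<alpha> \<^bold>\<longrightarrow> \<theta>) \<notin> U"
    then have "{\<beta>. (\<alpha> \<^bold>\<longrightarrow> \<beta>) \<in> U} = U"
      using closed_adjoin(1,2)[OF U(1), of \<alpha>] U(2) by (intro maximal[rule_format]) auto
    then show False using closed_adjoin(3)[OF U(1), of \<alpha>] that by simp
  qed
  \<comment> \<open>If neither formula is in \<open>U\<close>, then \<open>\<theta>\<close> follows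
    by cases; if both are, it follows by explosion.\<close>
  have "(\<^bold>\<not> \<alpha>) \<in> U \<longleftrightarrow> \<alpha> \<notin> U" for \<alpha>
    using outside[of \<alpha>] outside[of "\<^bold>\<not> \<alpha>"] U(3)
      taut_cases[of \<alpha> \<theta>, THEN closed_theorem[OF U(1)], THEN closed_MP[OF U(1)], THEN closed_MP[OF U(1)]]
      taut_absurd[of \<alpha> \<theta>, THEN closed_theorem[OF U(1)], THEN closed_MP[OF U(1)], THEN closed_MP[OF U(1)]]
    by blast
  then show thesis using that U by (auto simp: ultra_def)
qed

section \<open>Truth conditions of the connectives in maximal consistent sets\<close>

context
  fixes U :: "'v fm set"
  assumes ultra: "ultra U"
begin

lemma ultra_theorem: "\<turnstile> \<alpha> \<Longrightarrow> \<alpha> \<in> U"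
  using ultra by (simp add: ultra_def closed_def)

lemma ultra_MP: "(\<alpha> \<^bold>\<longrightarrow> \<beta>) \<in> U \<Longrightarrow> \<alpha> \<in> U \<Longrightarrow> \<beta> \<in> U"
  using ultra by (auto simp: ultra_def closed_def)

lemma ultra_simps:
  shows ultra_Top: "\<^bold>\<top> \<in> U"
    and ultra_Neg: "(\<^bold>\<not> \<alpha>) \<in> U \<longleftrightarrow> \<alpha> \<notin> U"
    and ultra_Bot: "\<^bold>\<bottom> \<notin> U"
    and ultra_And: "\<alpha> \<^bold>\<and> \<beta> \<in> U \<longleftrightarrow> \<alpha> \<in> U \<and> \<beta> \<in> U"
    and ultra_Or: "\<alpha> \<^bold>\<or> \<beta> \<in> U \<longleftrightarrow> \<alpha> \<in> U \<or> \<beta> \<in> U"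
    and ultra_Imp: "(\<alpha> \<^bold>\<longrightarrow> \<beta>) \<in> U \<longleftrightarrow> (\<alpha> \<in> U \<longrightarrow> \<beta> \<in> U)"
    and ultra_Iff: "(\<alpha> \<^bold>\<longleftrightarrow> \<beta>) \<in> U \<longleftrightarrow> (\<alpha> \<in> U \<longleftrightarrow> \<beta> \<in> U)"
proof -
  show neg: "(\<^bold>\<not> \<alpha>) \<in> U \<longleftrightarrow> \<alpha> \<notin> U" for \<alpha>
    using ultra by (simp add: ultra_def)
  show "\<^bold>\<top> \<in> U" "\<^bold>\<bottom> \<notin> U"
    using ultra_theorem[OF taut_Top] ultra_theorem[OF taut_Bot] neg by auto
  show "\<alpha> \<^bold>\<and> \<beta> \<in> U \<longleftrightarrow> \<alpha> \<in> U \<and> \<beta> \<in> U"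
    using taut_And[of \<alpha> \<beta>, THEN ultra_theorem, THEN ultra_MP] ultra_MP[of \<beta> "\<alpha> \<^bold>\<and> \<beta>"] by blast
  show "\<alpha> \<^bold>\<or> \<beta> \<in> U \<longleftrightarrow> \<alpha> \<in> U \<or> \<beta> \<in> U"
    using taut_Or(1,3)[of \<alpha> \<beta>, THEN ultra_theorem, THEN ultra_MP]
      taut_Or(2)[of \<beta> \<alpha>, THEN ultra_theorem, THEN ultra_MP] ultra_MP[of "\<^bold>\<not> \<alpha>" \<beta>]
      neg[of \<alpha>] by blast
  show "(\<alpha> \<^bold>\<longrightarrow> \<beta>) \<in> U \<longleftrightarrow> (\<alpha> \<in> U \<longrightarrow> \<beta> \<in> U)"
    using taut_K[of \<beta> \<alpha>, THEN ultra_theorem, THEN ultra_MP]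
      taut_absurd[of \<alpha> \<beta>, THEN ultra_theorem, THEN ultra_MP] ultra_MP[of \<alpha> \<beta>]
      neg[of \<alpha>] by blast
  show "(\<alpha> \<^bold>\<longleftrightarrow> \<beta>) \<in> U \<longleftrightarrow> (\<alpha> \<in> U \<longleftrightarrow> \<beta> \<in> U)"
    using taut_Iff[of \<alpha> \<beta>, THEN ultra_theorem, THEN ultra_MP, THEN ultra_MP]
      neg[of \<alpha>] neg[of \<beta>] by blast
qed

end

text \<open>By Lindenbaum, a closed set is the intersection of its \<open>ultra\<close> extensions.
  Membership in it, and provability in particular, thus becomes a Boolean computation with
  \<open>ultra_simps\<close>.\<close>

lemma closed_iff_ultra:
  assumes "closed T"
  shows "\<alpha> \<in> T \<longleftrightarrow> (\<forall>U. ultra U \<longrightarrow> T \<subseteq> U \<longrightarrow> \<alpha> \<in> U)"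
  using ultra_extension[OF assms, of \<alpha>] by blast

lemma provable_iff_ultra: "\<turnstile> \<alpha> \<longleftrightarrow> (\<forall>U. ultra U \<longrightarrow> \<alpha> \<in> U)"
  using closed_iff_ultra[OF closed_theorems, of \<alpha>] ultra_theorem by blast

section \<open>Persistence under the box\<close>

lemma Box_mono: "\<turnstile> \<alpha> \<^bold>\<longrightarrow> \<beta> \<Longrightarrow> \<turnstile> \<^bold>\<box> \<alpha> \<^bold>\<longrightarrow> \<^bold>\<box> \<beta>"
  by (rule MP[OF K Box_Nec])

text \<open>\<open>Add\<close> turns \<open>\<top> \<leadsto> \<alpha>\<close> into
  \<open>\<box>\<top> \<leadsto> \<box>\<alpha>\<close>, and \<open>A4\<close> with the theorem
  \<open>\<box>\<top>\<close> yields \<open>\<box>\<alpha>\<close>.\<close>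

lemma Univ_imp_Box: "\<turnstile> \<^bold>[\<forall>\<^bold>] \<alpha> \<^bold>\<longrightarrow> \<^bold>\<box> \<alpha>"
  unfolding provable_iff_ultra
proof (intro allI impI)
  fix U :: "'a fm set" assume U: "ultra U"
  show "(\<^bold>[\<forall>\<^bold>] \<alpha> \<^bold>\<longrightarrow> \<^bold>\<box> \<alpha>) \<in> U"
    using ultra_theorem[OF U Add[of "\<^bold>\<top>" \<alpha>]] ultra_theorem[OF U A4[of "\<^bold>\<box> \<^bold>\<top>" "\<^bold>\<box> \<alpha>"]]
      ultra_theorem[OF U Box_Nec[OF taut_Top]]
    by (simp add: ultra_simps[OF U])
qed

text \<open>By \<open>A10\<close> a strict implication is equivalent to its own
  \<open>[\<forall>]\<close>, which implies its box.\<close>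

lemma SImp_persistent: "\<turnstile> (\<alpha> \<^bold>\<leadsto> \<beta>) \<^bold>\<longrightarrow> \<^bold>\<box> (\<alpha> \<^bold>\<leadsto> \<beta>)"
  unfolding provable_iff_ultra
proof (intro allI impI)
  fix U :: "'a fm set" assume U: "ultra U"
  show "((\<alpha> \<^bold>\<leadsto> \<beta>) \<^bold>\<longrightarrow> \<^bold>\<box> (\<alpha> \<^bold>\<leadsto> \<beta>)) \<in> U"
    using ultra_theorem[OF U A10[of \<alpha> \<beta>]] ultra_theorem[OF U Univ_imp_Box[of "\<alpha> \<^bold>\<leadsto> \<beta>"]]
    by (simp add: ultra_simps[OF U])
qed

text \<open>For \<open>s\<close> the strict implication, \<open>A10\<close> and \<open>A9\<close>
  give \<open>[\<forall>] \<not> [\<forall>] s\<close>, hence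
  \<open>\<box> \<not> [\<forall>] s\<close>. The return from \<open>\<not> [\<forall>] s\<close> to
  \<open>\<not> s\<close> is made under \<open>\<box>\<close>, where \<open>K\<close> provides
  monotonicity.\<close>

lemma Neg_SImp_persistent: "\<turnstile> \<^bold>\<not> (\<alpha> \<^bold>\<leadsto> \<beta>) \<^bold>\<longrightarrow> \<^bold>\<box> (\<^bold>\<not> (\<alpha> \<^bold>\<leadsto> \<beta>))"
proof -
  let ?s = "\<alpha> \<^bold>\<leadsto> \<beta>"
  have "\<turnstile> \<^bold>\<not> (\<^bold>[\<forall>\<^bold>] ?s) \<^bold>\<longrightarrow> \<^bold>\<not> ?s"
    unfolding provable_iff_ultra using ultra_theorem A10[of \<alpha> \<beta>]
    by (fastforce simp: ultra_simps)
  note step = Box_mono[OF this]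
  show ?thesis
    unfolding provable_iff_ultra
  proof (intro allI impI)
    fix U :: "'a fm set" assume U: "ultra U"
    show "(\<^bold>\<not> ?s \<^bold>\<longrightarrow> \<^bold>\<box> (\<^bold>\<not> ?s)) \<in> U"
      using ultra_theorem[OF U A10[of \<alpha> \<beta>]] ultra_theorem[OF U A9[of ?s]] ultra_theorem[OF U step]
        ultra_theorem[OF U Univ_imp_Box[of "\<^bold>\<not> (\<^bold>[\<forall>\<^bold>] ?s)"]]
      by (simp add: ultra_simps[OF U])
  qed
qed

text \<open>The consequences of the persistent members of \<open>F\<close>. This part of
  \<open>F\<close> is closed under \<open>\<box>\<close>, as the translated rule
  \<open>Box_Nec\<close> requires, and still decides every strict implication.\<close>

definition core :: "'v fm set \<Rightarrow> 'v fm set" where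
  "core F = {\<chi>. \<exists>\<xi>\<in>F. (\<turnstile> \<xi> \<^bold>\<longrightarrow> \<^bold>\<box> \<xi>) \<and> (\<turnstile> \<xi> \<^bold>\<longrightarrow> \<chi>)}"

context
  fixes F :: "'v fm set"
  assumes F: "ultra F"
begin

lemma core_subset: "core F \<subseteq> F"
  by (auto simp: core_def intro: ultra_MP[OF F ultra_theorem[OF F]])

lemma core_theorem: "\<turnstile> \<alpha> \<Longrightarrow> \<alpha> \<in> core F"
proof -
  assume a: "\<turnstile> \<alpha>"
  have "\<turnstile> \<^bold>\<top> \<^bold>\<longrightarrow> \<^bold>\<box> \<^bold>\<top>" "\<turnstile> \<^bold>\<top> \<^bold>\<longrightarrow> \<alpha>"
    using MP[OF taut_K] Box_Nec taut_Top a by blast+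
  then show ?thesis using ultra_Top[OF F] by (auto simp: core_def)
qed

lemma closed_core: "closed (core F)"
proof -
  have "\<beta> \<in> core F" if ab: "(\<alpha> \<^bold>\<longrightarrow> \<beta>) \<in> core F" "\<alpha> \<in> core F" for \<alpha> \<beta>
  proof -
    obtain \<xi> \<eta> where x: "\<xi> \<in> F" "\<turnstile> \<xi> \<^bold>\<longrightarrow> \<^bold>\<box> \<xi>" "\<turnstile> \<xi> \<^bold>\<longrightarrow> (\<alpha> \<^bold>\<longrightarrow> \<beta>)"
      and y: "\<eta> \<in> F" "\<turnstile> \<eta> \<^bold>\<longrightarrow> \<^bold>\<box> \<eta>" "\<turnstile> \<eta> \<^bold>\<longrightarrow> \<alpha>"
      using ab unfolding core_def by blast
    \<comment> \<open>A conjunction of persistent formulas is persistent, so a single witness serves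
      both premises.\<close>
    have "\<turnstile> \<^bold>\<box> \<xi> \<^bold>\<longrightarrow> \<^bold>\<box> (\<eta> \<^bold>\<longrightarrow> \<xi> \<^bold>\<and> \<eta>)" by (rule Box_mono) (rule taut_And)
    then have "\<turnstile> \<xi> \<^bold>\<and> \<eta> \<^bold>\<longrightarrow> \<^bold>\<box> (\<xi> \<^bold>\<and> \<eta>)"
      using x(2) y(2) K[of \<eta> "\<xi> \<^bold>\<and> \<eta>"] unfolding provable_iff_ultra
      by (simp add: ultra_simps)
    moreover have "\<turnstile> \<xi> \<^bold>\<and> \<eta> \<^bold>\<longrightarrow> \<beta>"
      using x(3) y(3) unfolding provable_iff_ultra by (simp add: ultra_simps)
    moreover have "\<xi> \<^bold>\<and> \<eta> \<in> F" using x(1) y(1) by (simp add: ultra_simps[OF F])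
    ultimately show ?thesis by (auto simp: core_def)
  qed
  then show ?thesis using core_theorem by (auto simp: closed_def)
qed

lemma core_iff_ultra: "\<alpha> \<in> core F \<longleftrightarrow> (\<forall>U. ultra U \<longrightarrow> core F \<subseteq> U \<longrightarrow> \<alpha> \<in> U)"
  by (rule closed_iff_ultra[OF closed_core])

lemma core_MP: "(\<alpha> \<^bold>\<longrightarrow> \<beta>) \<in> core F \<Longrightarrow> \<alpha> \<in> core F \<Longrightarrow> \<beta> \<in> core F"
  by (rule closed_MP[OF closed_core])

text \<open>The witness \<open>\<xi>\<close> stays the same: it implies \<open>\<box>\<xi>\<close>,
  which implies \<open>\<box>\<alpha>\<close>.\<close>

lemma core_Box: "\<alpha> \<in> core F \<Longrightarrow> \<^bold>\<box> \<alpha> \<in> core F"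
proof -
  assume "\<alpha> \<in> core F"
  then obtain \<xi> where x: "\<xi> \<in> F" "\<turnstile> \<xi> \<^bold>\<longrightarrow> \<^bold>\<box> \<xi>" "\<turnstile> \<xi> \<^bold>\<longrightarrow> \<alpha>" by (auto simp: core_def)
  have "\<turnstile> \<xi> \<^bold>\<longrightarrow> \<^bold>\<box> \<alpha>"
    using x(2) Box_mono[OF x(3)] unfolding provable_iff_ultra by (simp add: ultra_simps)
  then show ?thesis using x by (auto simp: core_def)
qed

lemma core_Box_mono: "(\<alpha> \<^bold>\<longrightarrow> \<beta>) \<in> core F \<Longrightarrow> (\<^bold>\<box> \<alpha> \<^bold>\<longrightarrow> \<^bold>\<box> \<beta>) \<in> core F"
  by (rule core_MP[OF core_theorem[OF K] core_Box])

text \<open>By persistence, the formula is its own witness.\<close>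

lemma core_SImp: "(\<alpha> \<^bold>\<leadsto> \<beta>) \<in> F \<Longrightarrow> (\<alpha> \<^bold>\<leadsto> \<beta>) \<in> core F"
  and core_Neg_SImp: "(\<alpha> \<^bold>\<leadsto> \<beta>) \<notin> F \<Longrightarrow> \<^bold>\<not> (\<alpha> \<^bold>\<leadsto> \<beta>) \<in> core F"
  using SImp_persistent[of \<alpha> \<beta>] Neg_SImp_persistent[of \<alpha> \<beta>] taut_I[of "\<alpha> \<^bold>\<leadsto> \<beta>"]
    taut_I[of "\<^bold>\<not> (\<alpha> \<^bold>\<leadsto> \<beta>)"] ultra_Neg[OF F, of "\<alpha> \<^bold>\<leadsto> \<beta>"]
  unfolding core_def by blast+

end

section \<open>Irreducible components of strict implications\<close>

text \<open>None of \<open>A5\<close> (read from right to left), \<open>A2\<close> and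
  \<open>A3\<close> splits the pair further.\<close>

definition irreducible :: "'v fm \<Rightarrow> 'v fm \<Rightarrow> bool" where
  "irreducible \<alpha> \<beta> \<longleftrightarrow> \<not> (\<exists>\<alpha>' \<beta>'. \<alpha> = \<^bold>\<not> \<alpha>' \<and> \<beta> = \<^bold>\<not> \<beta>') \<and>
     \<not> (\<exists>\<alpha>\<^sub>1 \<alpha>\<^sub>2. \<alpha> = \<alpha>\<^sub>1 \<^bold>\<or> \<alpha>\<^sub>2) \<and> \<not> (\<exists>\<beta>\<^sub>1 \<beta>\<^sub>2. \<beta> = \<beta>\<^sub>1 \<^bold>\<and> \<beta>\<^sub>2)"

text \<open>The leaves of the splitting. It is a relation because a disjunction on the left and a
  conjunction on the right may be split in either order.\<close>

inductive component :: "'v fm \<Rightarrow> 'v fm \<Rightarrow> 'v fm \<Rightarrow> 'v fm \<Rightarrow> bool" where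
  self: "irreducible \<alpha> \<beta> \<Longrightarrow> component \<alpha> \<beta> \<alpha> \<beta>"
| neg: "component \<beta> \<alpha> \<gamma> \<delta> \<Longrightarrow> component (\<^bold>\<not> \<alpha>) (\<^bold>\<not> \<beta>) \<gamma> \<delta>"
| or1: "component \<alpha>\<^sub>1 \<beta> \<gamma> \<delta> \<Longrightarrow> component (\<alpha>\<^sub>1 \<^bold>\<or> \<alpha>\<^sub>2) \<beta> \<gamma> \<delta>"
| or2: "component \<alpha>\<^sub>2 \<beta> \<gamma> \<delta> \<Longrightarrow> component (\<alpha>\<^sub>1 \<^bold>\<or> \<alpha>\<^sub>2) \<beta> \<gamma> \<delta>"
| and1: "component \<alpha> \<beta>\<^sub>1 \<gamma> \<delta> \<Longrightarrow> component \<alpha> (\<beta>\<^sub>1 \<^bold>\<and> \<beta>\<^sub>2) \<gamma> \<delta>"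
| and2: "component \<alpha> \<beta>\<^sub>2 \<gamma> \<delta> \<Longrightarrow> component \<alpha> (\<beta>\<^sub>1 \<^bold>\<and> \<beta>\<^sub>2) \<gamma> \<delta>"

lemma component_irreducible:
  "irreducible \<alpha> \<beta> \<Longrightarrow> component \<alpha> \<beta> \<gamma> \<delta> \<longleftrightarrow> \<gamma> = \<alpha> \<and> \<delta> = \<beta>"
  by (auto simp: irreducible_def elim: component.cases intro: component.self)

lemma component_Neg: "component (\<^bold>\<not> \<alpha>) (\<^bold>\<not> \<beta>) \<gamma> \<delta> \<longleftrightarrow> component \<beta> \<alpha> \<gamma> \<delta>"
  by (auto simp: irreducible_def elim: component.cases intro: component.neg)

text \<open>Inversion takes an induction: the right side may have been split first, and the two
  splittings have to be commuted. The same holds for \<open>component_And\<close>.\<close>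

lemma component_Or:
  "component (\<alpha>\<^sub>1 \<^bold>\<or> \<alpha>\<^sub>2) \<beta> \<gamma> \<delta> \<longleftrightarrow> component \<alpha>\<^sub>1 \<beta> \<gamma> \<delta> \<or> component \<alpha>\<^sub>2 \<beta> \<gamma> \<delta>"
proof
  show "component \<alpha>\<^sub>1 \<beta> \<gamma> \<delta> \<or> component \<alpha>\<^sub>2 \<beta> \<gamma> \<delta>" if "component (\<alpha>\<^sub>1 \<^bold>\<or> \<alpha>\<^sub>2) \<beta> \<gamma> \<delta>"
    using that
    by (induction "\<alpha>\<^sub>1 \<^bold>\<or> \<alpha>\<^sub>2" \<beta> \<gamma> \<delta> rule: component.induct)
      (auto simp: irreducible_def intro: component.intros)
qed (auto intro: component.intros)

lemma component_And:
  "component \<alpha> (\<beta>\<^sub>1 \<^bold>\<and> \<beta>\<^sub>2) \<gamma> \<delta> \<longleftrightarrow> component \<alpha> \<beta>\<^sub>1 \<gamma> \<delta> \<or> component \<alpha> \<beta>\<^sub>2 \<gamma> \<delta>"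
proof
  show "component \<alpha> \<beta>\<^sub>1 \<gamma> \<delta> \<or> component \<alpha> \<beta>\<^sub>2 \<gamma> \<delta>" if "component \<alpha> (\<beta>\<^sub>1 \<^bold>\<and> \<beta>\<^sub>2) \<gamma> \<delta>"
    using that
    by (induction \<alpha> "\<beta>\<^sub>1 \<^bold>\<and> \<beta>\<^sub>2" \<gamma> \<delta> rule: component.induct)
      (auto simp: irreducible_def intro: component.intros)
qed (auto intro: component.intros)

text \<open>For the termination of \<open>tr\<close>: the constructor \<open>\<leadsto>\<close>
  itself adds one to the size, so a weak bound suffices.\<close>

lemma component_size:
  "component \<alpha> \<beta> \<gamma> \<delta> \<Longrightarrow> size \<gamma> + size \<delta> \<le> size \<alpha> + size \<beta>"
  by (induction rule: component.induct) auto

text \<open>Induction along the splitting. The measure is the total size, because \<open>Neg\<close>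
  exchanges the two sides.\<close>

lemma component_induct [case_names irreducible Neg Or And]:
  assumes "\<And>\<alpha> \<beta>. irreducible \<alpha> \<beta> \<Longrightarrow> P \<alpha> \<beta>"
    and "\<And>\<alpha> \<beta>. P \<beta> \<alpha> \<Longrightarrow> P (\<^bold>\<not> \<alpha>) (\<^bold>\<not> \<beta>)"
    and "\<And>\<alpha>\<^sub>1 \<alpha>\<^sub>2 \<beta>. P \<alpha>\<^sub>1 \<beta> \<Longrightarrow> P \<alpha>\<^sub>2 \<beta> \<Longrightarrow> P (\<alpha>\<^sub>1 \<^bold>\<or> \<alpha>\<^sub>2) \<beta>"
    and "\<And>\<alpha> \<beta>\<^sub>1 \<beta>\<^sub>2. P \<alpha> \<beta>\<^sub>1 \<Longrightarrow> P \<alpha> \<beta>\<^sub>2 \<Longrightarrow> P \<alpha> (\<beta>\<^sub>1 \<^bold>\<and> \<beta>\<^sub>2)"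
  shows "P \<alpha> \<beta>"
proof (induction "size \<alpha> + size \<beta>" arbitrary: \<alpha> \<beta> rule: less_induct)
  case less
  consider "irreducible \<alpha> \<beta>" | \<alpha>' \<beta>' where "\<alpha> = \<^bold>\<not> \<alpha>'" "\<beta> = \<^bold>\<not> \<beta>'"
    | \<alpha>\<^sub>1 \<alpha>\<^sub>2 where "\<alpha> = \<alpha>\<^sub>1 \<^bold>\<or> \<alpha>\<^sub>2" | \<beta>\<^sub>1 \<beta>\<^sub>2 where "\<beta> = \<beta>\<^sub>1 \<^bold>\<and> \<beta>\<^sub>2"
    unfolding irreducible_def by blast
  then show ?case using less assms by cases auto
qed

section \<open>The translation\<close>

locale fresh_variable =
  fixes F :: "'v fm set" and p :: 'v and \<phi> :: "'v fm"
  assumes ultra_F: "ultra F" and fresh: "p \<notin> vars \<phi>"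
begin

text \<open>A component without \<open>p\<close> keeps its value in \<open>F\<close>, so that
  formulas without \<open>p\<close> survive up to equivalence. For a component with
  \<open>p\<close>, the implication that \<open>A4\<close> forces is taken as the criterion; it is
  required in \<open>core F\<close> rather than in \<open>F\<close> so that it passes under
  \<open>\<box>\<close>.\<close>

function tr :: "'v fm \<Rightarrow> 'v fm" where
  "tr (Var q) = (if q = p then \<phi> else Var q)"
| "tr \<^bold>\<top> = \<^bold>\<top>"
| "tr \<^bold>\<bottom> = \<^bold>\<bottom>"
| "tr (\<^bold>\<not> \<alpha>) = \<^bold>\<not> tr \<alpha>"
| "tr (\<alpha> \<^bold>\<and> \<beta>) = tr \<alpha> \<^bold>\<and> tr \<beta>"
| "tr (\<alpha> \<^bold>\<or> \<beta>) = tr \<alpha> \<^bold>\<or> tr \<beta>"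
| "tr (\<alpha> \<^bold>\<longrightarrow> \<beta>) = (tr \<alpha> \<^bold>\<longrightarrow> tr \<beta>)"
| "tr (\<alpha> \<^bold>\<longleftrightarrow> \<beta>) = (tr \<alpha> \<^bold>\<longleftrightarrow> tr \<beta>)"
| "tr (\<^bold>\<box> \<alpha>) = \<^bold>\<box> (tr \<alpha>)"
| "tr (\<alpha> \<^bold>\<leadsto> \<beta>) =
    (if \<forall>\<gamma> \<delta>. component \<alpha> \<beta> \<gamma> \<delta> \<longrightarrow>
      (if p \<in> vars \<gamma> \<union> vars \<delta> then (tr \<gamma> \<^bold>\<longrightarrow> tr \<delta>) \<in> core F else (\<gamma> \<^bold>\<leadsto> \<delta>) \<in> F)
     then \<^bold>\<top> else \<^bold>\<bottom>)"
  by pat_completeness auto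
termination
  by (relation "measure size") (auto dest!: component_size)

text \<open>Names the test in the last clause of \<open>tr\<close>. That clause then leaves the simp
  set, and arguments go through \<open>tr_SImp\<close> and the splitting laws of
  \<open>holds\<close>.\<close>

definition holds :: "'v fm \<Rightarrow> 'v fm \<Rightarrow> bool" where
  "holds \<alpha> \<beta> \<longleftrightarrow> (\<forall>\<gamma> \<delta>. component \<alpha> \<beta> \<gamma> \<delta> \<longrightarrow>
     (if p \<in> vars \<gamma> \<union> vars \<delta> then (tr \<gamma> \<^bold>\<longrightarrow> tr \<delta>) \<in> core F else (\<gamma> \<^bold>\<leadsto> \<delta>) \<in> F))"

lemma tr_SImp: "tr (\<alpha> \<^bold>\<leadsto> \<beta>) = (if holds \<alpha> \<beta> then \<^bold>\<top> else \<^bold>\<bottom>)"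
  by (simp add: holds_def)

declare tr.simps(10) [simp del]

lemma holds_irreducible:
  "irreducible \<alpha> \<beta> \<Longrightarrow> holds \<alpha> \<beta> \<longleftrightarrow>
     (if p \<in> vars \<alpha> \<union> vars \<beta> then (tr \<alpha> \<^bold>\<longrightarrow> tr \<beta>) \<in> core F else (\<alpha> \<^bold>\<leadsto> \<beta>) \<in> F)"
  by (simp add: holds_def component_irreducible)

lemma holds_Neg: "holds (\<^bold>\<not> \<alpha>) (\<^bold>\<not> \<beta>) \<longleftrightarrow> holds \<beta> \<alpha>"
  and holds_Or: "holds (\<alpha>\<^sub>1 \<^bold>\<or> \<alpha>\<^sub>2) \<beta> \<longleftrightarrow> holds \<alpha>\<^sub>1 \<beta> \<and> holds \<alpha>\<^sub>2 \<beta>"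
  and holds_And: "holds \<alpha> (\<beta>\<^sub>1 \<^bold>\<and> \<beta>\<^sub>2) \<longleftrightarrow> holds \<alpha> \<beta>\<^sub>1 \<and> holds \<alpha> \<beta>\<^sub>2"
  unfolding holds_def component_Neg component_Or component_And by blast+

lemmas F_simps = ultra_simps[OF ultra_F]
lemmas F_theorem = ultra_theorem[OF ultra_F]
lemmas core_iff = core_iff_ultra[OF ultra_F]

lemma core_Bot: "(\<^bold>\<top> \<^bold>\<longrightarrow> \<^bold>\<bottom>) \<notin> core F"
  using core_subset[OF ultra_F] by (auto simp: F_simps dest: subsetD)

text \<open>All components of a pair without \<open>p\<close> are without \<open>p\<close>, and
  \<open>F\<close> respects the splittings by \<open>A5\<close>, \<open>A2\<close> and
  \<open>A3\<close>.\<close>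

lemma holds_fresh:
  "p \<notin> vars \<alpha> \<Longrightarrow> p \<notin> vars \<beta> \<Longrightarrow> holds \<alpha> \<beta> \<longleftrightarrow> (\<alpha> \<^bold>\<leadsto> \<beta>) \<in> F"
proof (induction \<alpha> \<beta> rule: component_induct)
  case (irreducible \<alpha> \<beta>)
  then show ?case by (simp add: holds_irreducible)
next
  case (Neg \<alpha> \<beta>)
  then show ?case using F_theorem[OF A5[of \<beta> \<alpha>]] by (simp add: holds_Neg F_simps)
next
  case (Or \<alpha>\<^sub>1 \<alpha>\<^sub>2 \<beta>)
  then show ?case using F_theorem[OF A2[of \<alpha>\<^sub>1 \<alpha>\<^sub>2 \<beta>]] by (simp add: holds_Or F_simps)
next
  case (And \<alpha> \<beta>\<^sub>1 \<beta>\<^sub>2)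
  then show ?case using F_theorem[OF A3[of \<alpha> \<beta>\<^sub>1 \<beta>\<^sub>2]] by (simp add: holds_And F_simps)
qed

text \<open>Equivalence over \<open>core F\<close>, not merely over \<open>F\<close>, is what passes
  under \<open>\<box>\<close>. The case of \<open>\<leadsto>\<close> works because
  \<open>core F\<close> decides strict implications as \<open>F\<close> does.\<close>

lemma tr_fresh: "p \<notin> vars \<alpha> \<Longrightarrow> (tr \<alpha> \<^bold>\<longleftrightarrow> \<alpha>) \<in> core F"
proof (induction \<alpha>)
  case (Box \<alpha>)
  then have "(tr \<alpha> \<^bold>\<longrightarrow> \<alpha>) \<in> core F" "(\<alpha> \<^bold>\<longrightarrow> tr \<alpha>) \<in> core F"
    by (auto simp: core_iff ultra_simps)
  then have "(\<^bold>\<box> (tr \<alpha>) \<^bold>\<longrightarrow> \<^bold>\<box> \<alpha>) \<in> core F" "(\<^bold>\<box> \<alpha> \<^bold>\<longrightarrow> \<^bold>\<box> (tr \<alpha>)) \<in> core F"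
    by (simp_all add: core_Box_mono[OF ultra_F])
  then show ?case
    by (auto simp: core_iff ultra_simps)
next
  case (SImp \<alpha> \<beta>)
  then have "holds \<alpha> \<beta> \<longleftrightarrow> (\<alpha> \<^bold>\<leadsto> \<beta>) \<in> F" by (simp add: holds_fresh)
  then have "if holds \<alpha> \<beta> then (\<alpha> \<^bold>\<leadsto> \<beta>) \<in> core F else \<^bold>\<not> (\<alpha> \<^bold>\<leadsto> \<beta>) \<in> core F"
    using core_SImp[OF ultra_F] core_Neg_SImp[OF ultra_F] by auto
  then show ?case
    by (auto simp: core_iff tr_SImp ultra_simps split: if_splits)
qed (auto simp: core_iff ultra_simps)

text \<open>This keeps \<open>A4\<close> true: components with \<open>p\<close> satisfy it by
  definition, the others by \<open>A4\<close> and \<open>tr_fresh\<close>.\<close>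

lemma holds_imp: "holds \<alpha> \<beta> \<Longrightarrow> (tr \<alpha> \<^bold>\<longrightarrow> tr \<beta>) \<in> core F"
proof (induction \<alpha> \<beta> rule: component_induct)
  case (irreducible \<alpha> \<beta>)
  show ?case
  proof (cases "p \<in> vars \<alpha> \<union> vars \<beta>")
    case True
    then show ?thesis using irreducible by (simp add: holds_irreducible)
  next
    case False
    then have "(\<alpha> \<^bold>\<leadsto> \<beta>) \<in> F" using irreducible by (simp add: holds_irreducible)
    then have "(\<alpha> \<^bold>\<longrightarrow> \<beta>) \<in> core F"
      by (rule core_MP[OF ultra_F core_theorem[OF ultra_F A4] core_SImp[OF ultra_F]])
    moreover have "(tr \<alpha> \<^bold>\<longleftrightarrow> \<alpha>) \<in> core F" "(tr \<beta> \<^bold>\<longleftrightarrow> \<beta>) \<in> core F"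
      using False by (simp_all add: tr_fresh)
    ultimately show ?thesis by (auto simp: core_iff ultra_simps)
  qed
qed (auto simp: holds_Neg holds_Or holds_And core_iff ultra_simps)

section \<open>The axioms and rules under the translation\<close>

lemma holds_Bot: "holds \<^bold>\<bottom> \<alpha>"
proof (induction "\<^bold>\<bottom> :: 'v fm" \<alpha> rule: component_induct)
  case (irreducible \<beta>)
  then show ?case using F_theorem[OF A1[of \<beta>]]
    by (auto simp: holds_irreducible F_simps core_iff ultra_simps)
qed (auto simp: holds_And)

lemma holds_Top: "holds \<alpha> \<^bold>\<top>"
proof (induction \<alpha> "\<^bold>\<top> :: 'v fm" rule: component_induct)
  case (irreducible \<alpha>)
  then show ?case using F_theorem[OF A1[of \<alpha>]]
    by (auto simp: holds_irreducible F_simps core_iff ultra_simps)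
qed (auto simp: holds_Or)

text \<open>Components without \<open>p\<close> use provability, through \<open>Univ_Nec\<close>;
  those with \<open>p\<close> use the translation. Both assumptions descend to conjuncts.\<close>

lemma holds_Univ:
  assumes "\<turnstile> \<alpha>" "tr \<alpha> \<in> core F" shows "holds \<^bold>\<top> \<alpha>"
  using assms
proof (induction "\<^bold>\<top> :: 'v fm" \<alpha> rule: component_induct)
  case (irreducible \<alpha>)
  then show ?case using F_theorem[OF Univ_Nec[of \<alpha>]]
    by (auto simp: holds_irreducible core_iff ultra_simps)
next
  case (And \<beta>\<^sub>1 \<beta>\<^sub>2)
  have "\<turnstile> \<beta>\<^sub>1" "\<turnstile> \<beta>\<^sub>2" using And(3) taut_And MP by blast+
  moreover have "tr \<beta>\<^sub>1 \<in> core F" "tr \<beta>\<^sub>2 \<in> core F"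
    using And(4) by (auto simp: core_iff ultra_simps)
  ultimately show ?case using And by (simp add: holds_And)
qed

text \<open>The pair on the left is irreducible. If \<open>p\<close> occurs, the test asks whether
  \<open>\<top>\<close> implies a truth constant over the consistent \<open>core F\<close>;
  otherwise \<open>A10\<close> decides in \<open>F\<close>.\<close>

lemma holds_Univ_SImp: "holds \<^bold>\<top> (\<alpha> \<^bold>\<leadsto> \<beta>) \<longleftrightarrow> holds \<alpha> \<beta>"
proof (cases "p \<in> vars \<alpha> \<union> vars \<beta>")
  case True
  then show ?thesis
    using core_Bot core_theorem[OF ultra_F taut_I]
    by (auto simp: holds_irreducible irreducible_def tr_SImp)
next
  case False
  then show ?thesis
    using F_theorem[OF A10[of \<alpha> \<beta>]] by (simp add: holds_fresh F_simps)
qed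

text \<open>Since \<open>\<top>\<close> is not a negation, the pair is irreducible: with
  \<open>p\<close> only a truth constant is tested, without \<open>p\<close> axiom \<open>A9\<close>
  applies in \<open>F\<close>. \<open>holds_Univ_Bot\<close> is alike, with \<open>\<bottom>\<close>
  and \<open>A11\<close>.\<close>

lemma holds_Neg_Univ: "\<not> holds \<^bold>\<top> \<alpha> \<Longrightarrow> holds \<^bold>\<top> (\<^bold>\<not> (\<^bold>[\<forall>\<^bold>] \<alpha>))"
proof (cases "p \<in> vars \<alpha>")
  case True
  moreover assume "\<not> holds \<^bold>\<top> \<alpha>"
  ultimately show ?thesis
    by (auto simp: holds_irreducible irreducible_def tr_SImp core_iff ultra_simps)
next
  case False
  moreover assume "\<not> holds \<^bold>\<top> \<alpha>"
  ultimately show ?thesis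
    using F_theorem[OF A9[of \<alpha>]] by (simp add: holds_fresh F_simps)
qed

lemma holds_Univ_Bot: "holds \<^bold>\<top> \<alpha> \<Longrightarrow> holds (\<^bold>\<not> (\<^bold>[\<forall>\<^bold>] \<alpha>)) \<^bold>\<bottom>"
proof (cases "p \<in> vars \<alpha>")
  case True
  moreover assume "holds \<^bold>\<top> \<alpha>"
  ultimately show ?thesis
    by (auto simp: holds_irreducible irreducible_def tr_SImp core_iff ultra_simps)
next
  case False
  moreover assume "holds \<^bold>\<top> \<alpha>"
  ultimately show ?thesis
    using F_theorem[OF A11[of \<alpha>]] by (simp add: holds_fresh F_simps)
qed

text \<open>Boxes block splitting, so with \<open>p\<close> the pair is tested as a whole:
  \<open>holds_imp\<close> gives an implication in \<open>core F\<close>, and \<open>K\<close>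
  carries it under \<open>\<box>\<close>. Without \<open>p\<close>, \<open>Add\<close> applies in
  \<open>F\<close>.\<close>

lemma holds_Box: "holds \<alpha> \<beta> \<Longrightarrow> holds (\<^bold>\<box> \<alpha>) (\<^bold>\<box> \<beta>)"
proof (cases "p \<in> vars \<alpha> \<union> vars \<beta>")
  case True
  moreover assume "holds \<alpha> \<beta>"
  ultimately show ?thesis
    using core_Box_mono[OF ultra_F holds_imp]
    by (auto simp: holds_irreducible irreducible_def)
next
  case False
  moreover assume "holds \<alpha> \<beta>"
  ultimately show ?thesis
    using F_theorem[OF Add[of \<alpha> \<beta>]] by (simp add: holds_fresh F_simps)
qed

lemma tr_inst: "tr (inst \<sigma> c) = inst (\<lambda>n. tr (\<sigma> n)) c"
  by (induction c) auto

text \<open>Instances of \<open>Taut\<close> and \<open>K\<close> translate to instances of the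
  same. In the other axioms strict implications become truth constants, which reduces them to the
  laws of \<open>holds\<close>. Landing in \<open>core F\<close> carries the induction through
  \<open>Box_Nec\<close>.\<close>

lemma tr_theorem: "\<turnstile> \<alpha> \<Longrightarrow> tr \<alpha> \<in> core F"
proof (induction rule: MS2IC.induct)
  case (Taut a \<sigma>)
  then show ?case by (simp add: tr_inst core_theorem[OF ultra_F] MS2IC.Taut)
next
  case (K \<alpha> \<beta>)
  then show ?case by (simp add: core_theorem[OF ultra_F] MS2IC.K)
next
  case (A4 \<alpha> \<beta>)
  then show ?case using holds_imp[of \<alpha> \<beta>]
    by (auto simp: core_iff tr_SImp ultra_simps)
next
  case (MP \<alpha> \<beta>)
  then show ?case using core_MP[OF ultra_F] by simp
next
  case (Univ_Nec \<alpha>)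
  then show ?case by (simp add: tr_SImp holds_Univ core_theorem[OF ultra_F] taut_Top)
next
  case (Box_Nec \<alpha>)
  then show ?case by (simp add: core_Box[OF ultra_F])
next
  case (A1 \<alpha>)
  show ?case by (simp add: core_iff tr_SImp ultra_simps holds_Bot holds_Top)
next
  case (A2 \<alpha> \<beta> \<gamma>)
  show ?case by (simp add: core_iff tr_SImp ultra_simps holds_Or)
next
  case (A3 \<alpha> \<beta> \<gamma>)
  show ?case by (simp add: core_iff tr_SImp ultra_simps holds_And)
next
  case (A5 \<alpha> \<beta>)
  show ?case by (simp add: core_iff tr_SImp ultra_simps holds_Neg)
next
  case (A8 \<alpha>)
  show ?case by (simp add: core_iff tr_SImp ultra_simps holds_Univ_SImp)
next
  case (A9 \<alpha>)
  show ?case by (simp add: core_iff tr_SImp ultra_simps holds_Neg_Univ)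
next
  case (A10 \<alpha> \<beta>)
  show ?case by (simp add: core_iff tr_SImp ultra_simps holds_Univ_SImp)
next
  case (A11 \<alpha>)
  show ?case by (simp add: core_iff tr_SImp ultra_simps holds_Univ_Bot)
next
  case (Add \<alpha> \<beta>)
  show ?case by (simp add: core_iff tr_SImp ultra_simps holds_Box)
qed

section \<open>Eliminating the fresh variable\<close>

text \<open>Needed for \<open>\<chi> = \<phi>\<close>; the general \<open>\<chi>\<close> lets the
  induction pass to conjuncts. Every component has \<open>Var p\<close> on its left, so its test is
  an implication from \<open>\<phi>\<close>, and \<open>tr_fresh\<close> removes \<open>tr\<close>
  on the right.\<close>

lemma holds_Var:
  "p \<notin> vars \<chi> \<Longrightarrow> (\<phi> \<^bold>\<longrightarrow> \<chi>) \<in> core F \<Longrightarrow> holds (Var p) \<chi>"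
proof (induction "Var p" \<chi> rule: component_induct)
  case (irreducible \<chi>)
  then show ?case using tr_fresh[of \<chi>]
    by (auto simp: holds_irreducible core_iff ultra_simps)
next
  case (And \<chi>\<^sub>1 \<chi>\<^sub>2)
  have "(\<phi> \<^bold>\<longrightarrow> \<chi>\<^sub>1) \<in> core F" "(\<phi> \<^bold>\<longrightarrow> \<chi>\<^sub>2) \<in> core F"
    using And(4) by (auto simp: core_iff ultra_simps)
  then show ?case using And by (simp add: holds_And)
qed

lemma upper_continuity:
  assumes "p \<notin> vars \<psi>" and "\<turnstile> ((Var p \<^bold>\<leadsto> \<phi>) \<^bold>\<and> (\<^bold>\<box> (Var p))) \<^bold>\<longrightarrow> \<psi>"
  shows "(\<^bold>\<box> \<phi> \<^bold>\<longrightarrow> \<psi>) \<in> F"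
proof -
  have "holds (Var p) \<phi>"
    using holds_Var[OF fresh] core_theorem[OF ultra_F taut_I] by blast
  \<comment> \<open>\<open>tr\<close> sends \<open>Var p\<close> to \<open>\<phi>\<close> itself and
    \<open>p \<leadsto> \<phi>\<close> to \<open>\<top>\<close>, so the translated premise has this
    very form.\<close>
  then have "((\<^bold>\<top> \<^bold>\<and> \<^bold>\<box> \<phi>) \<^bold>\<longrightarrow> tr \<psi>) \<in> F"
    using tr_theorem[OF assms(2)] core_subset[OF ultra_F] by (auto simp: tr_SImp)
  moreover have "(tr \<psi> \<^bold>\<longleftrightarrow> \<psi>) \<in> F"
    using tr_fresh[OF assms(1)] core_subset[OF ultra_F] by blast
  ultimately show ?thesis by (simp add: F_simps)
qed

end

theorem theorem4p13:
  fixes p :: 'v and \<phi> \<psi> :: "'v fm"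
  assumes "p \<notin> vars \<phi>" and "p \<notin> vars \<psi>"
    and "\<turnstile> ((Var p \<^bold>\<leadsto> \<phi>) \<^bold>\<and> (\<^bold>\<box> (Var p))) \<^bold>\<longrightarrow> \<psi>"
  shows "\<turnstile> (\<^bold>\<box> \<phi>) \<^bold>\<longrightarrow> \<psi>"
  unfolding provable_iff_ultra
proof (intro allI impI)
  fix F :: "'v fm set" assume "ultra F"
  \<comment> \<open>Provability is membership in all \<open>ultra\<close> sets, so the translation
    is built anew for each \<open>F\<close>.\<close>
  then interpret fresh_variable F p \<phi> by unfold_locales (use assms in auto)
  show "(\<^bold>\<box> \<phi> \<^bold>\<longrightarrow> \<psi>) \<in> F" using assms(2,3) by (rule upper_continuity)
qed

end
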